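(* HyperQPTL is strictly more expressive than FO$[<,E]$: for every FO$[<,E]$ sentence over $AP$ there is an equivalent HyperQPTL formula (equivalent meaning satisfied by exactly the same sets of traces $T\subseteq(2^{AP})^\omega$), but there is a HyperQPTL formula for which no equivalent FO$[<,E]$ sentence exists.
   Context: A trace over $AP$ is an infinite sequence $t\in(2^{AP})^\omega$; $t[i]$ is its $i$-th element. HyperQPTL syntax: $\varphi ::= \forall\pi.\varphi \mid \exists\pi.\varphi \mid \exists q.\varphi \mid \forall q.\varphi \mid \psi$, $\psi ::= a_\pi \mid q \mid \neg\psi \mid \psi\vee\psi \mid \mathsf{X}\psi \mid \psi\,\mathsf{U}\,\psi$, where $a\in AP$, $\pi$ ranges over trace variables and $q$ over propositional variables (quantifiers in prenex form). Semantics over a set of traces $T$, an assignment $\Pi$ (mapping trace variables to traces of $T$ and each propositional variable $q$ to a trace in $(2^{\{q\}})^\omega$) and a position $i$: $\Pi,i\models_T a_\pi$ iff $a\in\Pi(\pi)[i]$; $\Pi,i\models_T q$ iff $q\in\Pi(q)[i]$; Boolean connectives as usual; $\mathsf X\varphi$ holds at $i$ iff $\varphi$ holds at $i+1$; $\varphi_1\mathsf U\varphi_2$ holds at $i$ iff there is $j\ge i$ where $\varphi_2$ holds and $\varphi_1$ holds at all $k$ with $i\le k<j$; $\exists\pi.\varphi$ holds iff $\varphi$ holds under $\Pi[\pi\mapsto t]$ for some $t\in T$; $\exists q.\varphi$ holds iff $\varphi$ holds under $\Pi[q\mapsto t]$ for some $t\in(2^{\{q\}})^\omega$; universal quantifiers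 dual. $T\models\varphi$ iff $\emptyset,0\models_T\varphi$. FO$[<,E]$: first-order formulas built from $P_a(x)$, $x<y$, $x=y$, $E(x,y)$ with $\neg,\vee,\exists x$, interpreted over a set of traces $T$ with variables ranging over $T\times\mathbb N$: $P_a((t,n))$ iff $a\in t[n]$; $(t_1,n_1)<(t_2,n_2)$ iff $t_1=t_2$ and $n_1<n_2$; $E((t_1,n_1),(t_2,n_2))$ iff $n_1=n_2$.
   Formalization: AP is taken finite and nonempty: for infinite AP the sentence "E(x,y) and x≠y for some x,y" (at least two traces) has no HyperQPTL equivalent, and for empty AP there are only two trace sets, so strictness fails. *)

theory Defs
  imports Main
begin

text \<open>
  The set of atomic propositions is the type variable \<open>'ap\<close>, which the theorem constrains to be
  finite (and which is nonempty, as every type). Without finiteness the translation from FO[<,E]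
  fails: \<open>E(x,y) \<and> x \<noteq> y\<close> says that two traces differ, whereas a HyperQPTL formula only inspects
  finitely many propositions. Trace variables, propositional variables and
  first-order variables are three separate copies of \<open>nat\<close>.
\<close>

type_synonym 'ap trace = "nat \<Rightarrow> 'ap set"

datatype 'ap qptl_body =
    TAtom 'ap nat            \<comment> \<open>\<open>a\<^sub>\<pi>\<close>\<close>
  | PVar nat
  | BNot "'ap qptl_body"
  | BOr "'ap qptl_body" "'ap qptl_body"
  | Next "'ap qptl_body"
  | Until "'ap qptl_body" "'ap qptl_body"

datatype 'ap hyperqptl =
    AllTrace nat "'ap hyperqptl"
  | ExTrace nat "'ap hyperqptl"
  | ExProp nat "'ap hyperqptl"
  | AllProp nat "'ap hyperqptl"
  | Body "'ap qptl_body"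

text \<open>
  The assignment \<open>\<Pi>\<close> is split into a partial map on trace variables and a partial map on
  propositional variables; \<open>\<emptyset>\<close> is the pair of empty maps. An atom whose variable is unassigned is
  false, which never matters for the closed formulas considered below.
\<close>

type_synonym 'ap trace_asg = "nat \<rightharpoonup> 'ap trace"
type_synonym prop_asg = "nat \<rightharpoonup> nat trace"

definition prop_traces :: "nat \<Rightarrow> nat trace set" where
  "prop_traces q = {t. \<forall>i. t i \<subseteq> {q}}"

fun sat_body :: "'ap trace_asg \<Rightarrow> prop_asg \<Rightarrow> nat \<Rightarrow> 'ap qptl_body \<Rightarrow> bool" where
  "sat_body \<Pi> \<Theta> i (TAtom a \<pi>) = (\<exists>t. \<Pi> \<pi> = Some t \<and> a \<in> t i)"
| "sat_body \<Pi> \<Theta> i (PVar q) = (\<exists>t. \<Theta> q = Some t \<and> q \<in> t i)"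
| "sat_body \<Pi> \<Theta> i (BNot \<psi>) = (\<not> sat_body \<Pi> \<Theta> i \<psi>)"
| "sat_body \<Pi> \<Theta> i (BOr \<psi>1 \<psi>2) = (sat_body \<Pi> \<Theta> i \<psi>1 \<or> sat_body \<Pi> \<Theta> i \<psi>2)"
| "sat_body \<Pi> \<Theta> i (Next \<psi>) = sat_body \<Pi> \<Theta> (i + 1) \<psi>"
| "sat_body \<Pi> \<Theta> i (Until \<psi>1 \<psi>2) =
     (\<exists>j\<ge>i. sat_body \<Pi> \<Theta> j \<psi>2 \<and> (\<forall>k. i \<le> k \<and> k < j \<longrightarrow> sat_body \<Pi> \<Theta> k \<psi>1))"

fun sat_hyperqptl ::
  "'ap trace set \<Rightarrow> 'ap trace_asg \<Rightarrow> prop_asg \<Rightarrow> nat \<Rightarrow> 'ap hyperqptl \<Rightarrow> bool" where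
  "sat_hyperqptl T \<Pi> \<Theta> i (AllTrace \<pi> \<phi>) = (\<forall>t\<in>T. sat_hyperqptl T (\<Pi>(\<pi> \<mapsto> t)) \<Theta> i \<phi>)"
| "sat_hyperqptl T \<Pi> \<Theta> i (ExTrace \<pi> \<phi>) = (\<exists>t\<in>T. sat_hyperqptl T (\<Pi>(\<pi> \<mapsto> t)) \<Theta> i \<phi>)"
| "sat_hyperqptl T \<Pi> \<Theta> i (ExProp q \<phi>) =
     (\<exists>t\<in>prop_traces q. sat_hyperqptl T \<Pi> (\<Theta>(q \<mapsto> t)) i \<phi>)"
| "sat_hyperqptl T \<Pi> \<Theta> i (AllProp q \<phi>) =
     (\<forall>t\<in>prop_traces q. sat_hyperqptl T \<Pi> (\<Theta>(q \<mapsto> t)) i \<phi>)"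
| "sat_hyperqptl T \<Pi> \<Theta> i (Body \<psi>) = sat_body \<Pi> \<Theta> i \<psi>"

fun body_trace_vars :: "'ap qptl_body \<Rightarrow> nat set" where
  "body_trace_vars (TAtom a \<pi>) = {\<pi>}"
| "body_trace_vars (PVar q) = {}"
| "body_trace_vars (BNot \<psi>) = body_trace_vars \<psi>"
| "body_trace_vars (BOr \<psi>1 \<psi>2) = body_trace_vars \<psi>1 \<union> body_trace_vars \<psi>2"
| "body_trace_vars (Next \<psi>) = body_trace_vars \<psi>"
| "body_trace_vars (Until \<psi>1 \<psi>2) = body_trace_vars \<psi>1 \<union> body_trace_vars \<psi>2"

fun body_prop_vars :: "'ap qptl_body \<Rightarrow> nat set" where
  "body_prop_vars (TAtom a \<pi>) = {}"
| "body_prop_vars (PVar q) = {q}"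
| "body_prop_vars (BNot \<psi>) = body_prop_vars \<psi>"
| "body_prop_vars (BOr \<psi>1 \<psi>2) = body_prop_vars \<psi>1 \<union> body_prop_vars \<psi>2"
| "body_prop_vars (Next \<psi>) = body_prop_vars \<psi>"
| "body_prop_vars (Until \<psi>1 \<psi>2) = body_prop_vars \<psi>1 \<union> body_prop_vars \<psi>2"

fun free_trace_vars :: "'ap hyperqptl \<Rightarrow> nat set" where
  "free_trace_vars (AllTrace \<pi> \<phi>) = free_trace_vars \<phi> - {\<pi>}"
| "free_trace_vars (ExTrace \<pi> \<phi>) = free_trace_vars \<phi> - {\<pi>}"
| "free_trace_vars (ExProp q \<phi>) = free_trace_vars \<phi>"
| "free_trace_vars (AllProp q \<phi>) = free_trace_vars \<phi>"
| "free_trace_vars (Body \<psi>) = body_trace_vars \<psi>"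

fun free_prop_vars :: "'ap hyperqptl \<Rightarrow> nat set" where
  "free_prop_vars (AllTrace \<pi> \<phi>) = free_prop_vars \<phi>"
| "free_prop_vars (ExTrace \<pi> \<phi>) = free_prop_vars \<phi>"
| "free_prop_vars (ExProp q \<phi>) = free_prop_vars \<phi> - {q}"
| "free_prop_vars (AllProp q \<phi>) = free_prop_vars \<phi> - {q}"
| "free_prop_vars (Body \<psi>) = body_prop_vars \<psi>"

definition closed_hyperqptl :: "'ap hyperqptl \<Rightarrow> bool" where
  "closed_hyperqptl \<phi> \<longleftrightarrow> free_trace_vars \<phi> = {} \<and> free_prop_vars \<phi> = {}"

definition models_hyperqptl :: "'ap trace set \<Rightarrow> 'ap hyperqptl \<Rightarrow> bool" where
  "models_hyperqptl T \<phi> \<longleftrightarrow> sat_hyperqptl T Map.empty Map.empty 0 \<phi>"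

datatype 'ap fo =
    FPred 'ap nat
  | FLess nat nat
  | FEq nat nat
  | FLevel nat nat         \<comment> \<open>\<open>E(x,y)\<close>\<close>
  | FNot "'ap fo"
  | FOr "'ap fo" "'ap fo"
  | FEx nat "'ap fo"

text \<open>As above, atoms with an unassigned variable are false; this is irrelevant for sentences.\<close>

fun sat_fo :: "'ap trace set \<Rightarrow> (nat \<rightharpoonup> 'ap trace \<times> nat) \<Rightarrow> 'ap fo \<Rightarrow> bool" where
  "sat_fo T \<nu> (FPred a x) = (\<exists>t n. \<nu> x = Some (t, n) \<and> a \<in> t n)"
| "sat_fo T \<nu> (FLess x y) =
     (\<exists>t1 n1 t2 n2. \<nu> x = Some (t1, n1) \<and> \<nu> y = Some (t2, n2) \<and> t1 = t2 \<and> n1 < n2)"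
| "sat_fo T \<nu> (FEq x y) =
     (\<exists>t1 n1 t2 n2. \<nu> x = Some (t1, n1) \<and> \<nu> y = Some (t2, n2) \<and> (t1, n1) = (t2, n2))"
| "sat_fo T \<nu> (FLevel x y) =
     (\<exists>t1 n1 t2 n2. \<nu> x = Some (t1, n1) \<and> \<nu> y = Some (t2, n2) \<and> n1 = n2)"
| "sat_fo T \<nu> (FNot \<phi>) = (\<not> sat_fo T \<nu> \<phi>)"
| "sat_fo T \<nu> (FOr \<phi>1 \<phi>2) = (sat_fo T \<nu> \<phi>1 \<or> sat_fo T \<nu> \<phi>2)"
| "sat_fo T \<nu> (FEx x \<phi>) = (\<exists>p \<in> T \<times> UNIV. sat_fo T (\<nu>(x \<mapsto> p)) \<phi>)"

fun fo_free_vars :: "'ap fo \<Rightarrow> nat set" where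
  "fo_free_vars (FPred a x) = {x}"
| "fo_free_vars (FLess x y) = {x, y}"
| "fo_free_vars (FEq x y) = {x, y}"
| "fo_free_vars (FLevel x y) = {x, y}"
| "fo_free_vars (FNot \<phi>) = fo_free_vars \<phi>"
| "fo_free_vars (FOr \<phi>1 \<phi>2) = fo_free_vars \<phi>1 \<union> fo_free_vars \<phi>2"
| "fo_free_vars (FEx x \<phi>) = fo_free_vars \<phi> - {x}"

definition fo_sentence :: "'ap fo \<Rightarrow> bool" where
  "fo_sentence \<phi> \<longleftrightarrow> fo_free_vars \<phi> = {}"

definition models_fo :: "'ap trace set \<Rightarrow> 'ap fo \<Rightarrow> bool" where
  "models_fo T \<phi> \<longleftrightarrow> sat_fo T Map.empty \<phi>"

definition equivalent_formulas :: "'ap hyperqptl \<Rightarrow> 'ap fo \<Rightarrow> bool" where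
  "equivalent_formulas \<psi> \<phi> \<longleftrightarrow> (\<forall>T :: 'ap trace set. models_hyperqptl T \<psi> \<longleftrightarrow> models_fo T \<phi>)"

end

(*
  Translation: a first-order variable ranging over pairs (t, n) becomes a trace variable for t
  together with a propositional variable whose first occurrence encodes n.  Sentences are first put
  into prenex form with pairwise distinct bound variables; this preserves truth only over nonempty
  sets of traces, so a dummy outermost trace quantifier is added to get the empty set right.

  Strictness: "every subset of the positions is the set of a-positions of some trace" holds in the
  set of all traces, but by Cantor's theorem in no countable set of traces.  By the downward
  Loewenheim-Skolem argument, no FO[<,E] sentence separates all traces from every countable set.
*)
theory Submission
  imports Defs "HOL-Library.Countable_Set"
begin

section \<open>Prenex form\<close>

lemma sat_fo_cong:
  "(\<And>x. x \<in> fo_free_vars \<phi> \<Longrightarrow> \<nu> x = \<mu> x) \<Longrightarrow> sat_fo T \<nu> \<phi> = sat_fo T \<mu> \<phi>"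
proof (induction \<phi> arbitrary: \<nu> \<mu>)
  case (FOr \<phi>1 \<phi>2)
  have "sat_fo T \<nu> \<phi>1 = sat_fo T \<mu> \<phi>1" "sat_fo T \<nu> \<phi>2 = sat_fo T \<mu> \<phi>2"
    using FOr.prems by (intro FOr.IH; simp)+
  then show ?case by simp
next
  case (FEx x \<phi>)
  have "sat_fo T (\<nu>(x \<mapsto> p)) \<phi> = sat_fo T (\<mu>(x \<mapsto> p)) \<phi>" for p
    using FEx.prems by (intro FEx.IH) auto
  then show ?case by simp
next
  case (FNot \<phi>)
  then show ?case by (metis fo_free_vars.simps(5) sat_fo.simps(5))
qed simp_all

text \<open>\<open>True\<close> stands for an existential and \<open>False\<close> for a universal quantifier; the quantifiers bind
  the variables \<open>k\<close>, \<open>k + 1\<close>, and so on.\<close>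

fun quantify ::
  "'ap trace set \<Rightarrow> bool list \<Rightarrow> nat \<Rightarrow> ((nat \<rightharpoonup> 'ap trace \<times> nat) \<Rightarrow> bool) \<Rightarrow>
    (nat \<rightharpoonup> 'ap trace \<times> nat) \<Rightarrow> bool" where
  "quantify T [] k P \<nu> = P \<nu>"
| "quantify T (b # bs) k P \<nu> =
     (if b then \<exists>p \<in> T \<times> UNIV. quantify T bs (Suc k) P (\<nu>(k \<mapsto> p))
      else \<forall>p \<in> T \<times> UNIV. quantify T bs (Suc k) P (\<nu>(k \<mapsto> p)))"

lemma quantify_append:
  "quantify T (bs @ cs) k P \<nu> = quantify T bs k (quantify T cs (k + length bs) P) \<nu>"
  by (induction bs arbitrary: k \<nu>) auto

lemma quantify_not:
  "quantify T (map Not bs) k (\<lambda>\<nu>. \<not> P \<nu>) \<nu> \<longleftrightarrow> \<not> quantify T bs k P \<nu>"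
  by (induction bs arbitrary: k \<nu>) auto

text \<open>An existential quantifier over an empty range would falsify the left side even where
  \<open>R \<nu>\<close> holds. Hence the prenex form is only sound over nonempty
  \<open>T\<close>.\<close>

lemma quantify_disj:
  assumes "T \<noteq> {}" and "\<And>\<nu> j p. k \<le> j \<Longrightarrow> R (\<nu>(j \<mapsto> p)) = R \<nu>"
  shows "quantify T bs k (\<lambda>\<nu>. P \<nu> \<or> R \<nu>) \<nu> \<longleftrightarrow> quantify T bs k P \<nu> \<or> R \<nu>"
  using assms(2)
proof (induction bs arbitrary: k \<nu>)
  case (Cons b bs)
  have "T \<times> (UNIV :: nat set) \<noteq> {}"
    using assms(1) by auto
  moreover have "quantify T bs (Suc k) (\<lambda>\<nu>. P \<nu> \<or> R \<nu>) (\<nu>(k \<mapsto> p)) \<longleftrightarrow>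
      quantify T bs (Suc k) P (\<nu>(k \<mapsto> p)) \<or> R \<nu>" for p
    using Cons.IH[of "Suc k" "\<nu>(k \<mapsto> p)"] Cons.prems by (simp del: fun_upd_apply)
  ultimately show ?case by (cases b) auto
qed simp

fun prefix :: "'ap fo \<Rightarrow> bool list" where
  "prefix (FNot \<phi>) = map Not (prefix \<phi>)"
| "prefix (FOr \<phi>1 \<phi>2) = prefix \<phi>1 @ prefix \<phi>2"
| "prefix (FEx x \<phi>) = True # prefix \<phi>"
| "prefix _ = []"

text \<open>\<open>e\<close> sends each source variable to the index given to its current binder,
  and \<open>k\<close> is the next fresh index. The shift in the \<open>FOr\<close> clause keeps the
  variables bound in the two disjuncts apart, so that their prefixes can be concatenated.\<close>

fun matrix :: "(nat \<Rightarrow> nat) \<Rightarrow> nat \<Rightarrow> 'ap fo \<Rightarrow> 'ap fo" where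
  "matrix e k (FPred a x) = FPred a (e x)"
| "matrix e k (FLess x y) = FLess (e x) (e y)"
| "matrix e k (FEq x y) = FEq (e x) (e y)"
| "matrix e k (FLevel x y) = FLevel (e x) (e y)"
| "matrix e k (FNot \<phi>) = FNot (matrix e k \<phi>)"
| "matrix e k (FOr \<phi>1 \<phi>2) = FOr (matrix e k \<phi>1) (matrix e (k + length (prefix \<phi>1)) \<phi>2)"
| "matrix e k (FEx x \<phi>) = matrix (e(x := k)) (Suc k) \<phi>"

fun quantifier_free :: "'ap fo \<Rightarrow> bool" where
  "quantifier_free (FNot \<phi>) = quantifier_free \<phi>"
| "quantifier_free (FOr \<phi>1 \<phi>2) = (quantifier_free \<phi>1 \<and> quantifier_free \<phi>2)"
| "quantifier_free (FEx x \<phi>) = False"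
| "quantifier_free _ = True"

lemma quantifier_free_matrix: "quantifier_free (matrix e k \<phi>)"
  by (induction \<phi> arbitrary: e k) auto

lemma free_vars_matrix:
  "fo_free_vars (matrix e k \<phi>) \<subseteq> e ` fo_free_vars \<phi> \<union> {k..<k + length (prefix \<phi>)}"
proof (induction \<phi> arbitrary: e k)
  case (FOr \<phi>1 \<phi>2)
  show ?case
    using FOr.IH(1)[of e k] FOr.IH(2)[of e "k + length (prefix \<phi>1)"] by fastforce
next
  case (FEx x \<phi>)
  show ?case
  proof -
    have "(e(x := k)) ` fo_free_vars \<phi> \<subseteq> insert k (e ` fo_free_vars (FEx x \<phi>))"
      by auto
    moreover have "insert k {Suc k..<Suc k + length (prefix \<phi>)} = {k..<k + length (prefix (FEx x \<phi>))}"
      by auto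
    ultimately show ?thesis
      using FEx.IH[of "e(x := k)" "Suc k"] unfolding matrix.simps by blast
  qed
qed auto

text \<open>The bound on \<open>e\<close> keeps the outer variables below those that the prefix
  binds. In a disjunction the right prefix is first moved past the left matrix, then the left prefix
  past the right disjunct.\<close>

lemma quantify_matrix:
  assumes "T \<noteq> {}" and "\<And>x. x \<in> fo_free_vars \<phi> \<Longrightarrow> e x < k"
  shows "quantify T (prefix \<phi>) k (\<lambda>\<nu>. sat_fo T \<nu> (matrix e k \<phi>)) \<nu> = sat_fo T (\<nu> \<circ> e) \<phi>"
  using assms(2)
proof (induction \<phi> arbitrary: e k \<nu>)
  case (FNot \<phi>)
  then show ?case by (simp add: quantify_not)
next
  case (FOr \<phi>1 \<phi>2)
  define k' where "k' = k + length (prefix \<phi>1)"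
  let ?M1 = "\<lambda>\<nu>. sat_fo T \<nu> (matrix e k \<phi>1)" and ?M2 = "\<lambda>\<nu>. sat_fo T \<nu> (matrix e k' \<phi>2)"
  have IH2: "quantify T (prefix \<phi>2) k' ?M2 \<nu> = sat_fo T (\<nu> \<circ> e) \<phi>2" for \<nu>
    using FOr.prems by (intro FOr.IH(2)) (auto simp: k'_def intro: trans_less_add1)
  \<comment> \<open>All variables of the left matrix are below \<open>k'\<close>, where the right
    prefix starts.\<close>
  have "?M1 (\<nu>(j \<mapsto> p)) = ?M1 \<nu>" if "k' \<le> j" for \<nu> j p
    using free_vars_matrix[of e k \<phi>1] FOr.prems that
    by (intro sat_fo_cong) (force simp: k'_def)
  then have "quantify T (prefix \<phi>2) k' (\<lambda>\<nu>. ?M2 \<nu> \<or> ?M1 \<nu>) \<nu> \<longleftrightarrow>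
      sat_fo T (\<nu> \<circ> e) \<phi>2 \<or> ?M1 \<nu>" for \<nu>
    using quantify_disj[OF assms(1), of k' ?M1 "prefix \<phi>2" ?M2] IH2 by blast
  then have inner: "quantify T (prefix \<phi>2) k' (\<lambda>\<nu>. ?M1 \<nu> \<or> ?M2 \<nu>) =
      (\<lambda>\<nu>. ?M1 \<nu> \<or> sat_fo T (\<nu> \<circ> e) \<phi>2)"
    by (simp add: fun_eq_iff disj_commute)
  have "sat_fo T (\<nu>(j \<mapsto> p) \<circ> e) \<phi>2 = sat_fo T (\<nu> \<circ> e) \<phi>2" if "k \<le> j" for \<nu> j p
    using FOr.prems that by (intro sat_fo_cong) fastforce
  then have "quantify T (prefix \<phi>1) k (\<lambda>\<nu>. ?M1 \<nu> \<or> sat_fo T (\<nu> \<circ> e) \<phi>2) \<nu> \<longleftrightarrow>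
      quantify T (prefix \<phi>1) k ?M1 \<nu> \<or> sat_fo T (\<nu> \<circ> e) \<phi>2"
    by (rule quantify_disj[OF assms(1)])
  moreover have "quantify T (prefix \<phi>1) k ?M1 \<nu> = sat_fo T (\<nu> \<circ> e) \<phi>1"
    using FOr.prems by (intro FOr.IH(1)) auto
  ultimately show ?case
    unfolding prefix.simps matrix.simps sat_fo.simps quantify_append k'_def[symmetric] inner
    by blast
next
  case (FEx x \<phi>)
  have "quantify T (prefix \<phi>) (Suc k) (\<lambda>\<nu>. sat_fo T \<nu> (matrix (e(x := k)) (Suc k) \<phi>)) (\<nu>(k \<mapsto> p))
      = sat_fo T ((\<nu> \<circ> e)(x \<mapsto> p)) \<phi>" for p
  proof -
    \<comment> \<open>No other free variable of \<open>\<phi>\<close> is renamed to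
      \<open>k\<close>, so binding \<open>k\<close> before the renaming amounts to binding
      \<open>x\<close> after it.\<close>
    have "sat_fo T (\<nu>(k \<mapsto> p) \<circ> e(x := k)) \<phi> = sat_fo T ((\<nu> \<circ> e)(x \<mapsto> p)) \<phi>"
      using FEx.prems by (intro sat_fo_cong) fastforce
    moreover have "(e(x := k)) y < Suc k" if "y \<in> fo_free_vars \<phi>" for y
      using FEx.prems[of y] that by auto
    ultimately show ?thesis
      by (intro trans[OF FEx.IH])
  qed
  then show ?case by (simp add: comp_def)
qed simp_all

section \<open>From prenex sentences to HyperQPTL\<close>

abbreviation BAnd :: "'ap qptl_body \<Rightarrow> 'ap qptl_body \<Rightarrow> 'ap qptl_body" where
  "BAnd \<psi>1 \<psi>2 \<equiv> BNot (BOr (BNot \<psi>1) (BNot \<psi>2))"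

abbreviation BIff :: "'ap qptl_body \<Rightarrow> 'ap qptl_body \<Rightarrow> 'ap qptl_body" where
  "BIff \<psi>1 \<psi>2 \<equiv> BOr (BAnd \<psi>1 \<psi>2) (BNot (BOr \<psi>1 \<psi>2))"

abbreviation Eventually :: "'ap qptl_body \<Rightarrow> 'ap qptl_body" where
  "Eventually \<psi> \<equiv> Until (BOr \<psi> (BNot \<psi>)) \<psi>"

abbreviation Always :: "'ap qptl_body \<Rightarrow> 'ap qptl_body" where
  "Always \<psi> \<equiv> BNot (Eventually (BNot \<psi>))"

text \<open>The default \<open>0\<close> for the empty set makes every propositional trace encode a position, so the
  quantifiers over propositional variables need no guards.\<close>

definition position :: "nat \<Rightarrow> nat trace \<Rightarrow> nat" where
  "position q s = (if \<exists>i. q \<in> s i then LEAST i. q \<in> s i else 0)"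

definition decode :: "'ap trace_asg \<Rightarrow> prop_asg \<Rightarrow> nat \<rightharpoonup> 'ap trace \<times> nat" where
  "decode \<Pi> \<Theta> x = (case (\<Pi> x, \<Theta> x) of (Some t, Some s) \<Rightarrow> Some (t, position x s) | _ \<Rightarrow> None)"

lemma decode_upd:
  "decode (\<Pi>(x \<mapsto> t)) (\<Theta>(x \<mapsto> s)) = (decode \<Pi> \<Theta>)(x \<mapsto> (t, position x s))"
  by (auto simp: decode_def fun_eq_iff)

lemma position_Least:
  assumes "q \<in> s i"
  shows "q \<in> s (position q s)" and "position q s \<le> i" and "k < position q s \<Longrightarrow> q \<notin> s k"
proof -
  have pos: "position q s = (LEAST i. q \<in> s i)"
    using assms by (auto simp: position_def)
  show "q \<in> s (position q s)" "position q s \<le> i"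
    unfolding pos using assms by (rule LeastI, rule Least_le)
  show "q \<notin> s k" if "k < position q s"
    using that unfolding pos by (rule not_less_Least)
qed

lemma position_0: "(\<And>i. q \<notin> s i) \<Longrightarrow> position q s = 0"
  by (simp add: position_def)

lemma surj_position: "position q ` prop_traces q = UNIV"
proof -
  have "n \<in> position q ` prop_traces q" for n
  proof
    show "(\<lambda>i. if i = n then {q} else {}) \<in> prop_traces q"
      by (simp add: prop_traces_def)
    have "(LEAST i. i = n) = n"
      by (rule Least_equality) auto
    then show "n = position q (\<lambda>i. if i = n then {q} else {})"
      by (simp add: position_def)
  qed
  then show ?thesis by blast
qed

section \<open>First-order atoms as temporal formulas evaluated at time 0\<close>

definition at_position :: "'ap \<Rightarrow> nat \<Rightarrow> 'ap qptl_body" where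
  "at_position a x = BOr (Until (BNot (PVar x)) (BAnd (PVar x) (TAtom a x)))
     (BAnd (BNot (Eventually (PVar x))) (TAtom a x))"

text \<open>If \<open>x\<close> never occurs or holds at time 0, its position is 0 and the
  comparison is true. Otherwise \<open>y\<close> must not precede the first \<open>x\<close>. The
  conjunct \<open>Eventually (PVar y)\<close> is essential there: if \<open>y\<close> never occurs,
  its position is the default 0, although the \<open>Until\<close> would hold.\<close>

definition not_after :: "nat \<Rightarrow> nat \<Rightarrow> 'ap qptl_body" where
  "not_after x y = BOr (BNot (Eventually (PVar x))) (BOr (PVar x)
     (BAnd (Eventually (PVar y)) (Until (BNot (PVar y)) (PVar x))))"

definition same_trace :: "'ap list \<Rightarrow> nat \<Rightarrow> nat \<Rightarrow> 'ap qptl_body" where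
  "same_trace as x y = Always (foldr (\<lambda>a. BAnd (BIff (TAtom a x) (TAtom a y))) as
     (BOr (PVar x) (BNot (PVar x))))"

text \<open>The \<open>Until\<close> can only be witnessed by the first occurrence of
  \<open>x\<close>. If there is none, the default position is 0, the time of evaluation, so the
  second disjunct reads \<open>a\<close> there.\<close>

lemma sat_at_position:
  assumes "\<Pi> x = Some t" "\<Theta> x = Some s"
  shows "sat_body \<Pi> \<Theta> 0 (at_position a x) \<longleftrightarrow> a \<in> t (position x s)"
proof (cases "\<exists>i. x \<in> s i")
  case True
  then obtain i where i: "x \<in> s i" ..
  have "j = position x s" if "x \<in> s j" "\<forall>k<j. x \<notin> s k" for j
    using that position_Least(1,2)[of x s j] by (metis le_neq_implies_less)
  then have "(\<exists>j. (x \<in> s j \<and> a \<in> t j) \<and> (\<forall>k<j. x \<notin> s k)) \<longleftrightarrow> a \<in> t (position x s)"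
    using position_Least(1,3)[of x s i] i by metis
  then show ?thesis
    using assms i by (auto simp: at_position_def)
next
  case False
  then show ?thesis
    using assms by (auto simp: at_position_def position_0)
qed

lemma sat_not_after:
  assumes "\<Theta> x = Some s" "\<Theta> y = Some u"
  shows "sat_body \<Pi> \<Theta> 0 (not_after x y) \<longleftrightarrow> position x s \<le> position y u"
proof (cases "\<exists>i. x \<in> s i")
  case True
  then obtain i where i: "x \<in> s i" ..
  have zero: "x \<in> s 0 \<longleftrightarrow> position x s = 0"
    using position_Least(1)[of x s, OF i] position_Least(2)[of x s 0] by auto
  show ?thesis
  proof (cases "\<exists>j. y \<in> u j")
    case True
    then obtain j where j: "y \<in> u j" ..
    have "(\<exists>j. x \<in> s j \<and> (\<forall>k<j. y \<notin> u k)) \<longleftrightarrow> position x s \<le> position y u"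
      using position_Least[of x s] position_Least[of y u, OF j] i
      by (meson le_trans not_le order_less_le_trans)
    then show ?thesis
      using assms i j zero by (auto simp: not_after_def)
  next
    case False
    then show ?thesis
      using assms i zero by (auto simp: not_after_def position_0)
  qed
next
  case False
  then show ?thesis
    using assms by (auto simp: not_after_def position_0)
qed

text \<open>Traces are equal iff they agree on every proposition at every time. Here finiteness of
  the propositions enters, since the list \<open>as\<close> must contain all of them.\<close>

lemma sat_same_trace:
  assumes "set as = UNIV" "\<Pi> x = Some t" "\<Pi> y = Some u"
  shows "sat_body \<Pi> \<Theta> 0 (same_trace as x y) \<longleftrightarrow> t = u"
proof -
  have "sat_body \<Pi> \<Theta> i (foldr (\<lambda>a. BAnd (BIff (TAtom a x) (TAtom a y))) bs
      (BOr (PVar x) (BNot (PVar x)))) \<longleftrightarrow> (\<forall>a\<in>set bs. a \<in> t i \<longleftrightarrow> a \<in> u i)" for i bs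
    using assms(2,3) by (induction bs) auto
  then show ?thesis
    using assms(1) by (auto simp: same_trace_def fun_eq_iff)
qed

fun body_of :: "'ap list \<Rightarrow> 'ap fo \<Rightarrow> 'ap qptl_body" where
  "body_of as (FPred a x) = at_position a x"
| "body_of as (FLess x y) = BAnd (same_trace as x y) (BNot (not_after y x))"
| "body_of as (FEq x y) = BAnd (same_trace as x y) (BAnd (not_after x y) (not_after y x))"
| "body_of as (FLevel x y) = BAnd (not_after x y) (not_after y x)"
| "body_of as (FNot \<phi>) = BNot (body_of as \<phi>)"
| "body_of as (FOr \<phi>1 \<phi>2) = BOr (body_of as \<phi>1) (body_of as \<phi>2)"
| "body_of as (FEx x \<phi>) = undefined"

lemma sat_body_of:
  assumes "set as = UNIV" "quantifier_free \<phi>" "fo_free_vars \<phi> \<subseteq> dom \<Pi> \<inter> dom \<Theta>"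
  shows "sat_body \<Pi> \<Theta> 0 (body_of as \<phi>) \<longleftrightarrow> sat_fo T (decode \<Pi> \<Theta>) \<phi>"
  using assms(2,3)
  by (induction \<phi>) (auto simp: sat_at_position sat_not_after sat_same_trace[OF assms(1)] decode_def)

lemma vars_same_trace:
  "body_trace_vars (same_trace as x y) \<subseteq> {x, y}" "body_prop_vars (same_trace as x y) \<subseteq> {x, y}"
proof -
  let ?\<psi> = "\<lambda>as. foldr (\<lambda>a. BAnd (BIff (TAtom a x) (TAtom a y))) as (BOr (PVar x) (BNot (PVar x)))"
  have "body_trace_vars (?\<psi> as) \<subseteq> {x, y} \<and> body_prop_vars (?\<psi> as) \<subseteq> {x, y}"
    by (induction as) auto
  then show "body_trace_vars (same_trace as x y) \<subseteq> {x, y}"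
    and "body_prop_vars (same_trace as x y) \<subseteq> {x, y}"
    by (simp_all add: same_trace_def)
qed

lemma vars_body_of:
  assumes "quantifier_free \<phi>"
  shows "body_trace_vars (body_of as \<phi>) \<subseteq> fo_free_vars \<phi>"
    and "body_prop_vars (body_of as \<phi>) \<subseteq> fo_free_vars \<phi>"
  using assms vars_same_trace[of as]
  by (induction \<phi>) (auto simp: at_position_def not_after_def)

section \<open>Translation of quantifier prefixes\<close>

fun hyper :: "bool list \<Rightarrow> nat \<Rightarrow> 'ap qptl_body \<Rightarrow> 'ap hyperqptl" where
  "hyper [] k \<psi> = Body \<psi>"
| "hyper (b # bs) k \<psi> =
     (if b then ExTrace k (ExProp k (hyper bs (Suc k) \<psi>))
      else AllTrace k (AllProp k (hyper bs (Suc k) \<psi>)))"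

lemma free_vars_hyper:
  "free_trace_vars (hyper bs k \<psi>) = body_trace_vars \<psi> - {k..<k + length bs}"
  "free_prop_vars (hyper bs k \<psi>) = body_prop_vars \<psi> - {k..<k + length bs}"
  by (induction bs arbitrary: k) auto

text \<open>Updating both assignments at \<open>k\<close> updates the decoded assignment by a pair.
  As \<open>position k\<close> maps the propositional traces onto all of \<open>nat\<close>, the
  trace quantifier and the propositional quantifier together range over exactly
  \<open>T \<times> UNIV\<close>.\<close>

lemma sat_hyper:
  assumes "set as = UNIV" "quantifier_free \<phi>" "fo_free_vars \<phi> \<subseteq> {..<k + length bs}"
    and "{..<k} \<subseteq> dom \<Pi> \<inter> dom \<Theta>"
  shows "sat_hyperqptl T \<Pi> \<Theta> 0 (hyper bs k (body_of as \<phi>)) \<longleftrightarrow>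
    quantify T bs k (\<lambda>\<nu>. sat_fo T \<nu> \<phi>) (decode \<Pi> \<Theta>)"
  using assms(3,4)
proof (induction bs arbitrary: k \<Pi> \<Theta>)
  case Nil
  then show ?case
    using sat_body_of[OF assms(1,2), of \<Pi> \<Theta> T] by auto
next
  case (Cons b bs)
  let ?Q = "\<lambda>p. quantify T bs (Suc k) (\<lambda>\<nu>. sat_fo T \<nu> \<phi>) ((decode \<Pi> \<Theta>)(k \<mapsto> p))"
  have IH: "sat_hyperqptl T (\<Pi>(k \<mapsto> t)) (\<Theta>(k \<mapsto> s)) 0 (hyper bs (Suc k) (body_of as \<phi>)) \<longleftrightarrow>
      ?Q (t, position k s)" for t s
    unfolding decode_upd[symmetric] using Cons.prems
    by (intro Cons.IH) (auto simp: lessThan_Suc)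
  have "(\<exists>s\<in>prop_traces k. ?Q (t, position k s)) \<longleftrightarrow> (\<exists>n. ?Q (t, n))" for t
    using surj_position[of k] by (metis UNIV_I imageE)
  moreover have "(\<forall>s\<in>prop_traces k. ?Q (t, position k s)) \<longleftrightarrow> (\<forall>n. ?Q (t, n))" for t
    using surj_position[of k] by (metis UNIV_I imageE)
  ultimately show ?case
    by (simp add: IH)
qed

lemma equivalent_hyperqptl_exists:
  fixes \<phi> :: "'ap::finite fo"
  assumes "fo_sentence \<phi>"
  shows "\<exists>\<psi> :: 'ap hyperqptl. closed_hyperqptl \<psi> \<and> equivalent_formulas \<psi> \<phi>"
proof -
  obtain as :: "'ap list" where as: "set as = UNIV"
    using finite_list[OF finite_UNIV] by blast
  define m where "m = matrix id 0 \<phi>"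
  define \<psi> where "\<psi> = hyper (prefix \<phi>) 0 (body_of as m)"
  \<comment> \<open>Over the empty set a universal trace quantifier is true and an existential one
    false, so the dummy is chosen by the truth value of \<open>\<phi>\<close> there. Its index lies
    just beyond the variables bound in \<open>\<psi>\<close>.\<close>
  define \<psi>' where
    "\<psi>' = (if models_fo {} \<phi> then AllTrace (length (prefix \<phi>)) \<psi> else ExTrace (length (prefix \<phi>)) \<psi>)"
  have qf: "quantifier_free m"
    by (simp add: m_def quantifier_free_matrix)
  have fv: "fo_free_vars m \<subseteq> {..<length (prefix \<phi>)}"
    using assms free_vars_matrix[of id 0 \<phi>] by (auto simp: m_def fo_sentence_def)
  have fv_\<psi>: "free_trace_vars \<psi> = {}" "free_prop_vars \<psi> = {}"
    using fv vars_body_of[OF qf, of as] by (fastforce simp: \<psi>_def free_vars_hyper)+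
  \<comment> \<open>\<open>\<Pi>\<close> is arbitrary because the dummy quantifier leaves its own
    variable assigned.\<close>
  have indep: "sat_hyperqptl T \<Pi> Map.empty 0 \<psi> \<longleftrightarrow> models_fo T \<phi>"
    if "T \<noteq> {}" for T :: "'ap trace set" and \<Pi>
  proof -
    have "sat_hyperqptl T \<Pi> Map.empty 0 \<psi> \<longleftrightarrow>
        quantify T (prefix \<phi>) 0 (\<lambda>\<nu>. sat_fo T \<nu> m) (decode \<Pi> Map.empty)"
      unfolding \<psi>_def using fv by (intro sat_hyper as qf) auto
    also have "\<dots> \<longleftrightarrow> sat_fo T (decode \<Pi> Map.empty \<circ> id) \<phi>"
      unfolding m_def using assms by (intro quantify_matrix that) (auto simp: fo_sentence_def)
    also have "\<dots> \<longleftrightarrow> models_fo T \<phi>"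
      unfolding models_fo_def using assms by (intro sat_fo_cong) (simp add: fo_sentence_def)
    finally show ?thesis .
  qed
  have "models_hyperqptl T \<psi>' \<longleftrightarrow> models_fo T \<phi>" for T
  proof (cases "T = {}")
    case True
    then show ?thesis by (simp add: \<psi>'_def models_hyperqptl_def)
  next
    case False
    then show ?thesis using indep[OF False] by (auto simp: \<psi>'_def models_hyperqptl_def)
  qed
  moreover have "closed_hyperqptl \<psi>'"
    using fv_\<psi> by (auto simp: closed_hyperqptl_def \<psi>'_def)
  ultimately show ?thesis
    unfolding equivalent_formulas_def by blast
qed

section \<open>A HyperQPTL sentence without a first-order equivalent\<close>

instance fo :: (countable) countable
  by countable_datatype

text \<open>Assignments are given as finite association lists, of which there are only countably
  many over a countable set of traces.\<close>

definition witness :: "'ap trace set \<Rightarrow> nat \<Rightarrow> 'ap fo \<Rightarrow> (nat \<times> 'ap trace \<times> nat) list \<Rightarrow> 'ap trace \<times> nat"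
  where "witness T x \<phi> l = (SOME p. p \<in> T \<times> UNIV \<and> sat_fo T ((map_of l)(x \<mapsto> p)) \<phi>)"

text \<open>Only the trace component of a witness is added, since all positions are present anyway.
  The intersection with \<open>T\<close> discards arbitrary values of \<open>witness\<close> where
  no witness exists.\<close>

definition skolem_step :: "'ap trace set \<Rightarrow> 'ap trace set \<Rightarrow> 'ap trace set" where
  "skolem_step T S = S \<union>
     (T \<inter> (\<lambda>(x, \<phi>, l). fst (witness T x \<phi> l)) ` (UNIV \<times> UNIV \<times> lists (UNIV \<times> S \<times> UNIV)))"

definition skolem_hull :: "'ap trace set \<Rightarrow> 'ap trace set" where
  "skolem_hull T = (\<Union>n. (skolem_step T ^^ n) {})"

lemma skolem_hull_subset: "skolem_hull T \<subseteq> T"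
proof -
  have "(skolem_step T ^^ n) {} \<subseteq> T" for n
    by (induction n) (auto simp: skolem_step_def)
  then show ?thesis by (auto simp: skolem_hull_def)
qed

text \<open>Each stage adds at most one trace per variable, formula and finite list over the
  previous stage; these are countably many.\<close>

lemma countable_skolem_hull: "countable (skolem_hull (T :: 'ap::countable trace set))"
proof -
  have "countable ((skolem_step T ^^ n) {})" for n
    by (induction n) (auto simp: skolem_step_def intro!: countable_Int2 countable_image)
  then show ?thesis by (auto simp: skolem_hull_def)
qed

text \<open>This is the condition of the Tarski-Vaught test: the chosen witness enters one stage
  after all parameters are present.\<close>

lemma witness_in_skolem_hull:
  assumes l: "set l \<subseteq> UNIV \<times> skolem_hull T \<times> UNIV" and p: "p \<in> T \<times> UNIV"
    and "sat_fo T ((map_of l)(x \<mapsto> p)) \<phi>"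
  shows "\<exists>p \<in> skolem_hull T \<times> UNIV. sat_fo T ((map_of l)(x \<mapsto> p)) \<phi>"
proof -
  let ?S = "\<lambda>n. (skolem_step T ^^ n) {}" and ?w = "witness T x \<phi> l"
  have w: "?w \<in> T \<times> UNIV" "sat_fo T ((map_of l)(x \<mapsto> ?w)) \<phi>"
    using someI[of "\<lambda>p. p \<in> T \<times> UNIV \<and> sat_fo T ((map_of l)(x \<mapsto> p)) \<phi>" p] assms(2,3)
    unfolding witness_def by auto
  have mono: "?S m \<subseteq> ?S n" if "m \<le> n" for m n
    using that by (rule lift_Suc_mono_le[rotated]) (auto simp: skolem_step_def)
  \<comment> \<open>The list is finite and the stages increase, so a single stage contains all its
    traces.\<close>
  have "\<exists>n. set l \<subseteq> UNIV \<times> ?S n \<times> UNIV"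
    using l
  proof (induction l)
    case (Cons y l)
    then obtain n m where "set l \<subseteq> UNIV \<times> ?S n \<times> UNIV" "fst (snd y) \<in> ?S m"
      by (auto simp: skolem_hull_def)
    then have "set (y # l) \<subseteq> UNIV \<times> ?S (max n m) \<times> UNIV"
      using mono[of n "max n m"] mono[of m "max n m"] by (cases y) fastforce
    then show ?case by blast
  qed simp
  then obtain n where "l \<in> lists (UNIV \<times> ?S n \<times> UNIV)" by auto
  then have "fst ?w \<in> (\<lambda>(x, \<phi>, l). fst (witness T x \<phi> l)) ` (UNIV \<times> UNIV \<times> lists (UNIV \<times> ?S n \<times> UNIV))"
    by (intro image_eqI[of _ _ "(x, \<phi>, l)"]) simp_all
  then have "fst ?w \<in> ?S (Suc n)"
    using w(1) by (simp add: skolem_step_def mem_Times_iff)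
  then have "fst ?w \<in> skolem_hull T"
    unfolding skolem_hull_def by blast
  then show ?thesis
    using w(2) by (intro bexI[of _ ?w]) (auto simp: mem_Times_iff)
qed

text \<open>The Tarski-Vaught induction: the hull is an elementary substructure. Binding a variable
  prepends a pair to the list.\<close>

lemma sat_fo_skolem_hull:
  "set l \<subseteq> UNIV \<times> skolem_hull T \<times> UNIV \<Longrightarrow>
    sat_fo (skolem_hull T) (map_of l) \<phi> \<longleftrightarrow> sat_fo T (map_of l) \<phi>"
proof (induction \<phi> arbitrary: l)
  case (FEx x \<phi>)
  have IH: "sat_fo (skolem_hull T) ((map_of l)(x \<mapsto> p)) \<phi> \<longleftrightarrow> sat_fo T ((map_of l)(x \<mapsto> p)) \<phi>"
    if "p \<in> skolem_hull T \<times> UNIV" for p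
    using FEx.IH[of "(x, p) # l"] FEx.prems that by (cases p) (simp del: fun_upd_apply)
  have "(\<exists>p\<in>skolem_hull T \<times> UNIV. sat_fo T ((map_of l)(x \<mapsto> p)) \<phi>) \<longleftrightarrow>
      (\<exists>p\<in>T \<times> UNIV. sat_fo T ((map_of l)(x \<mapsto> p)) \<phi>)"
    using witness_in_skolem_hull[OF FEx.prems] skolem_hull_subset[of T] by blast
  then show ?case
    unfolding sat_fo.simps using IH by (simp cong: bex_cong)
qed simp_all

section \<open>The separating sentence and Cantor's theorem\<close>

definition all_sets_occur :: "'ap \<Rightarrow> 'ap hyperqptl" where
  "all_sets_occur a = AllProp 0 (ExTrace 0 (Body (Always (BIff (PVar 0) (TAtom a 0)))))"

text \<open>Propositional traces are in effect arbitrary sets of positions, so the propositional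
  quantifier acts as a second-order one.\<close>

lemma models_all_sets_occur:
  "models_hyperqptl T (all_sets_occur a) \<longleftrightarrow> (\<lambda>t. {i. a \<in> t i}) ` T = UNIV"
proof -
  have "sat_body [0 \<mapsto> t] [0 \<mapsto> s] 0 (Always (BIff (PVar 0) (TAtom a 0))) \<longleftrightarrow>
      {i. 0 \<in> s i} = {i. a \<in> t i}" for t s
    by auto
  then have "models_hyperqptl T (all_sets_occur a) \<longleftrightarrow>
      (\<forall>s\<in>prop_traces 0. \<exists>t\<in>T. {i. 0 \<in> s i} = {i. a \<in> t i})"
    unfolding models_hyperqptl_def all_sets_occur_def sat_hyperqptl.simps by simp
  moreover have "(\<lambda>s. {i. 0 \<in> s i}) ` prop_traces 0 = UNIV"
  proof -
    have "S \<in> (\<lambda>s. {i. 0 \<in> s i}) ` prop_traces 0" for S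
      by (rule image_eqI[of _ _ "\<lambda>i. if i \<in> S then {0} else {}"]) (auto simp: prop_traces_def)
    then show ?thesis by blast
  qed
  moreover have "(\<forall>s\<in>prop_traces 0. \<exists>t\<in>T. {i. 0 \<in> s i} = {i. a \<in> t i}) \<longleftrightarrow>
      (\<lambda>s. {i. 0 \<in> s i}) ` prop_traces 0 \<subseteq> (\<lambda>t. {i. a \<in> t i}) ` T"
    by (simp only: image_subset_iff image_iff)
  ultimately show ?thesis
    by (simp only: top.extremum_unique)
qed

lemma not_models_all_sets_occur:
  assumes "countable T"
  shows "\<not> models_hyperqptl T (all_sets_occur a)"
proof
  assume "models_hyperqptl T (all_sets_occur a)"
  then have *: "(\<lambda>t. {i. a \<in> t i}) ` T = UNIV"
    by (simp add: models_all_sets_occur)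
  \<comment> \<open>The image is all of \<open>UNIV\<close>, so \<open>T\<close> is nonempty and can
    be enumerated by \<open>nat\<close>, which gives a surjection from \<open>nat\<close> onto its
    power set.\<close>
  then have "range (from_nat_into T) = T"
    using assms by (intro range_from_nat_into) auto
  then have "(\<lambda>n. {i. a \<in> from_nat_into T n i}) ` UNIV = Pow UNIV"
    using * by (metis (no_types) Pow_UNIV image_image)
  then show False
    using Cantors_theorem by blast
qed

lemma all_sets_occur_not_fo:
  fixes a :: "'ap::countable"
  assumes "equivalent_formulas (all_sets_occur a) \<phi>"
  shows False
proof -
  let ?T = "UNIV :: 'ap trace set"
  have "models_hyperqptl ?T (all_sets_occur a)"
    unfolding models_all_sets_occur
    \<comment> \<open>A preimage of \<open>S\<close> is the trace with \<open>{a}\<close> exactly at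
      the positions in \<open>S\<close>.\<close>
    by (rule surjI[of _ "\<lambda>S i. if i \<in> S then {a} else {}"]) simp
  moreover have "\<not> models_hyperqptl (skolem_hull ?T) (all_sets_occur a)"
    by (intro not_models_all_sets_occur countable_skolem_hull)
  moreover have "models_fo (skolem_hull ?T) \<phi> \<longleftrightarrow> models_fo ?T \<phi>"
    \<comment> \<open>The empty list represents the empty assignment.\<close>
    using sat_fo_skolem_hull[of "[]" ?T \<phi>] by (simp add: models_fo_def)
  ultimately show False
    using assms by (simp add: equivalent_formulas_def)
qed

theorem theorem1:
  shows "(\<forall>\<phi> :: 'ap::finite fo. fo_sentence \<phi> \<longrightarrow>
            (\<exists>\<psi> :: 'ap hyperqptl. closed_hyperqptl \<psi> \<and> equivalent_formulas \<psi> \<phi>))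
       \<and> (\<exists>\<psi> :: 'ap hyperqptl. closed_hyperqptl \<psi> \<and>
            \<not> (\<exists>\<phi> :: 'ap fo. fo_sentence \<phi> \<and> equivalent_formulas \<psi> \<phi>))"
proof (intro conjI allI impI)
  fix \<phi> :: "'ap fo"
  assume "fo_sentence \<phi>"
  then show "\<exists>\<psi> :: 'ap hyperqptl. closed_hyperqptl \<psi> \<and> equivalent_formulas \<psi> \<phi>"
    by (rule equivalent_hyperqptl_exists)
next
  have "closed_hyperqptl (all_sets_occur a)" for a :: 'ap
    by (simp add: closed_hyperqptl_def all_sets_occur_def)
  then show "\<exists>\<psi> :: 'ap hyperqptl. closed_hyperqptl \<psi> \<and>
      \<not> (\<exists>\<phi> :: 'ap fo. fo_sentence \<phi> \<and> equivalent_formulas \<psi> \<phi>)"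
    \<comment> \<open>Finite types are countable, so the lemma applies to
      \<open>'ap\<close>.\<close>
    using all_sets_occur_not_fo by blast
qed

end
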